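(* For any signature $S$, any set $X$ of positive integers, and any word $w$ on $S$ of length $n\in\mathbb N$: (i) in the $X$-tilted $S_{\mathbb N}$-easterly wind poset, $\mathbf f^{\uparrow}(w)\preceq\mathbf f^{\downarrow}(w)$; (ii) $\mathbf f^{\uparrow}(w)$ is a minimal element and $\mathbf f^{\downarrow}(w)$ is a maximal element of the $X$-tilted $S_{\mathbb N}$-easterly wind poset.
   Context: A signature is a set $S$ with an arity map $|\cdot|:S\to\mathbb N$. An $S$-term is either the leaf $\ell$ or $s\,t_1\cdots t_{|s|}$ with $s\in S$ and $S$-terms $t_i$; $T(S)$ is the set of $S$-terms. Preorder traversal: root, then subterms left to right recursively. Internal nodes are numbered $1,\dots,\deg t$ in preorder; $\mathrm{dc}(t)$ is the word of their decorations. Children (leaves included) are numbered from $1$ left to right; the parent edge of internal node $i$ is $(\mathrm{pa}(i),\mathrm{lp}(i),i)$ with $i$ the $\mathrm{lp}(i)$-th child of $\mathrm{pa}(i)$, and $\mathrm{pa}(1)=1,\mathrm{lp}(1)=0$. Connection word: $\mathrm{cnc}(t)(i)=\mathrm{pa}(i)+1-2^{\mathrm{lp}(i)-a}$, $a$ the arity of the decoration of $\mathrm{pa}(i)$. Easterly wind order: $t_1\preceq t_2$ iff $\mathrm{dc}(t_1)=\mathrm{dc}(t_2)$ and $\mathrm{cnc}(t_1)\le\mathrm{cnc}(t_2)$ componentwise. For a set $X$ of positive integers, $\mathrm{tlt}(X)(t)$ is obtained by rearranging, for each internal node $i\in X$, the children of $i$ so that non-leaf children keep their relative order and precede the leaf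 children; $t$ is $X$-tilted if $\mathrm{tlt}(X)(t)=t$, and the $X$-tilted $S$-easterly wind poset is the set of $X$-tilted $S$-terms ordered by $\preceq$. $S_{\mathbb N}=S\sqcup\mathbb N$, where $n\in\mathbb N$ has arity $n$. For $s$ in a signature, the corolla $c(s)$ is $s\,\ell\cdots\ell$ (one internal node, $|s|$ leaves). For an $S_{\mathbb N}$-term $F$ with at least one leaf and a term $u$, $F\bullet u$ is obtained by replacing the leftmost leaf of $F$ by $u$. For $w=w_1\cdots w_n$: $\mathbf f^{\uparrow}(w):=n\,c(w_1)\cdots c(w_n)$ and $\mathbf f^{\downarrow}(w):=(\cdots((c(n)\bullet c(w_1))\bullet c(w_2))\cdots)\bullet c(w_n)$, where $c(n)$ is the corolla of $n\in\mathbb N$ (for $n=0$ both are the term $0$). *)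

theory Defs
  imports Complex_Main
begin

text \<open>A signature is a carrier set \<open>S\<close> (possibly empty) with an arity function \<open>ar\<close>, of which
  only the values on \<open>S\<close> matter. The datatype contains ill-formed terms; \<open>sterms S ar\<close>
  selects the terms in which each symbol is from \<open>S\<close> and has the right number of children.\<close>

datatype 's stm = Leaf | Node 's "'s stm list"

inductive_set sterms :: "'s set \<Rightarrow> ('s \<Rightarrow> nat) \<Rightarrow> 's stm set"
  for S :: "'s set" and ar :: "'s \<Rightarrow> nat" where
  Leaf: "Leaf \<in> sterms S ar"
| Node: "s \<in> S \<Longrightarrow> length ts = ar s \<Longrightarrow> \<forall>t\<in>set ts. t \<in> sterms S ar
    \<Longrightarrow> Node s ts \<in> sterms S ar"

text \<open>A node is addressed by the list of child positions (numbered from 1, leaves counted) on the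
  path from the root to it. \<open>nodes t\<close> lists the internal nodes in preorder, each with its
  decoration; the node numbered \<open>i\<close> is the entry at list index \<open>i - 1\<close>.\<close>

primrec nodes :: "'s stm \<Rightarrow> (nat list \<times> 's) list" where
  "nodes Leaf = []"
| "nodes (Node s ts) =
    ([], s) # concat (map (\<lambda>(j, ns). map (apfst ((#) j)) ns) (enumerate 1 (map nodes ts)))"

definition deg :: "'s stm \<Rightarrow> nat" where
  "deg t = length (nodes t)"

definition dc :: "'s stm \<Rightarrow> 's list" where
  "dc t = map snd (nodes t)"

definition addr :: "'s stm \<Rightarrow> nat \<Rightarrow> nat list" where
  "addr t i = fst (nodes t ! (i - 1))"

definition num :: "'s stm \<Rightarrow> nat list \<Rightarrow> nat" where
  "num t p = (THE i. i \<in> {1..deg t} \<and> addr t i = p)"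

definition pa :: "'s stm \<Rightarrow> nat \<Rightarrow> nat" where
  "pa t i = (if i = 1 then 1 else num t (butlast (addr t i)))"

definition lp :: "'s stm \<Rightarrow> nat \<Rightarrow> nat" where
  "lp t i = (if i = 1 then 0 else last (addr t i))"

definition cnc :: "('s \<Rightarrow> nat) \<Rightarrow> 's stm \<Rightarrow> nat \<Rightarrow> rat" where
  "cnc ar t i =
    of_nat (pa t i) + 1 - 2 powi (int (lp t i) - int (ar (dc t ! (pa t i - 1))))"

definition wind_le :: "('s \<Rightarrow> nat) \<Rightarrow> 's stm \<Rightarrow> 's stm \<Rightarrow> bool" where
  "wind_le ar t1 t2 \<longleftrightarrow> dc t1 = dc t2 \<and> (\<forall>i\<in>{1..deg t1}. cnc ar t1 i \<le> cnc ar t2 i)"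

text \<open>\<open>tilt_at t P\<close> moves the leaf children to the end at each internal node whose address
  satisfies \<open>P\<close>. Addresses refer to the original term \<open>t\<close>.\<close>

primrec tilt_at :: "'s stm \<Rightarrow> (nat list \<Rightarrow> bool) \<Rightarrow> 's stm" where
  "tilt_at Leaf = (\<lambda>P. Leaf)"
| "tilt_at (Node s ts) = (\<lambda>P.
    let us = map (\<lambda>(j, f). f (\<lambda>p. P (j # p))) (enumerate 1 (map tilt_at ts))
    in Node s (if P [] then filter (\<lambda>u. u \<noteq> Leaf) us @ filter (\<lambda>u. u = Leaf) us else us))"

definition tlt :: "nat set \<Rightarrow> 's stm \<Rightarrow> 's stm" where
  "tlt X t = tilt_at t (\<lambda>p. num t p \<in> X)"

text \<open>The carrier of the \<open>X\<close>-tilted easterly wind poset; its order is \<^const>\<open>wind_le\<close>.\<close>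

definition tilted :: "'s set \<Rightarrow> ('s \<Rightarrow> nat) \<Rightarrow> nat set \<Rightarrow> 's stm set" where
  "tilted S ar X = {t \<in> sterms S ar. tlt X t = t}"

definition minimal_in :: "'a set \<Rightarrow> ('a \<Rightarrow> 'a \<Rightarrow> bool) \<Rightarrow> 'a \<Rightarrow> bool" where
  "minimal_in A le t \<longleftrightarrow> t \<in> A \<and> (\<forall>u\<in>A. le u t \<longrightarrow> u = t)"

definition maximal_in :: "'a set \<Rightarrow> ('a \<Rightarrow> 'a \<Rightarrow> bool) \<Rightarrow> 'a \<Rightarrow> bool" where
  "maximal_in A le t \<longleftrightarrow> t \<in> A \<and> (\<forall>u\<in>A. le t u \<longrightarrow> u = t)"

text \<open>The signature \<open>S\<^sub>\<nat>\<close>: the disjoint union of \<open>S\<close> and \<open>\<nat>\<close>.\<close>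

definition sigN :: "'s set \<Rightarrow> ('s + nat) set" where
  "sigN S = S <+> UNIV"

definition arN :: "('s \<Rightarrow> nat) \<Rightarrow> 's + nat \<Rightarrow> nat" where
  "arN ar = case_sum ar (\<lambda>n. n)"

definition corolla :: "('s \<Rightarrow> nat) \<Rightarrow> 's \<Rightarrow> 's stm" where
  "corolla ar s = Node s (replicate (ar s) Leaf)"

primrec has_leaf :: "'s stm \<Rightarrow> bool" where
  "has_leaf Leaf = True"
| "has_leaf (Node s ts) = (True \<in> set (map has_leaf ts))"

text \<open>\<open>graft F u\<close> replaces the leftmost leaf of \<open>F\<close> by \<open>u\<close>; if \<open>F\<close> has no leaf, the result is
  the irrelevant value \<open>F\<close>.\<close>

fun graft :: "'s stm \<Rightarrow> 's stm \<Rightarrow> 's stm"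
  and graft_list :: "'s stm list \<Rightarrow> 's stm \<Rightarrow> 's stm list" where
  "graft Leaf u = u"
| "graft (Node s ts) u = Node s (graft_list ts u)"
| "graft_list [] u = []"
| "graft_list (t # ts) u = (if has_leaf t then graft t u # ts else t # graft_list ts u)"

definition f_up :: "('s \<Rightarrow> nat) \<Rightarrow> 's list \<Rightarrow> ('s + nat) stm" where
  "f_up ar w = Node (Inr (length w)) (map (\<lambda>s. corolla (arN ar) (Inl s)) w)"

definition f_down :: "('s \<Rightarrow> nat) \<Rightarrow> 's list \<Rightarrow> ('s + nat) stm" where
  "f_down ar w =
    foldl graft (corolla (arN ar) (Inr (length w))) (map (\<lambda>s. corolla (arN ar) (Inl s)) w)"

end

theory Submission imports Defs begin

text \<open>Since positions are at most arities, \<^const>\<open>cnc\<close> lies in \<open>[pa, pa + 1)\<close>; so the order compares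
  first the parents of a node (a larger parent is larger) and then its positions among its siblings
  (a smaller position is larger).

  In a term below \<open>f_up\<close> every non-root node is therefore a child of the root; as there are as many
  of them as the root has children, the term is \<open>f_up\<close>.

  In \<open>f_down\<close> all leaves come after all internal nodes in preorder. Hence, when a node is inserted,
  every slot with a larger parent, or with the same parent and a smaller position, is already
  occupied by an earlier node. If \<open>u\<close> is above \<open>f_down\<close>, then by induction on \<open>i\<close> the first \<open>i\<close> nodes
  of \<open>u\<close> and \<open>f_down\<close> have the same addresses. The same observation bounds the positions of the
  children of the root of \<open>f_down\<close>, which puts it above \<open>f_up\<close>.\<close>

section \<open>Preorder lists of internal nodes and their addresses\<close>

text \<open>The recursion in \<open>nodes\<close> starts numbering children at 1; a free starting
  position \<open>j\<close> is what inductions over the list of children need.\<close>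

definition nodes_from :: "nat \<Rightarrow> 's stm list \<Rightarrow> (nat list \<times> 's) list" where
  "nodes_from j ts = concat (map (\<lambda>(j, ns). map (apfst ((#) j)) ns) (enumerate j (map nodes ts)))"

lemma nodes_from_simps [simp]:
  "nodes_from j [] = []"
  "nodes_from j (t # ts) = map (apfst ((#) j)) (nodes t) @ nodes_from (Suc j) ts"
  by (simp_all add: nodes_from_def)

lemma nodes_Node: "nodes (Node s ts) = ([], s) # nodes_from 1 ts"
  by (simp add: nodes_from_def)

declare nodes.simps(2) [simp del]
declare nodes_Node [simp]

lemma sterms_Node_iff:
  "Node s ts \<in> sterms S ar \<longleftrightarrow> s \<in> S \<and> length ts = ar s \<and> (\<forall>t\<in>set ts. t \<in> sterms S ar)"
  by (subst sterms.simps) simp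

lemma nodes_eq_Nil_iff [simp]: "nodes t = [] \<longleftrightarrow> t = Leaf"
  by (cases t) simp_all

lemma nodes_from_leaves [simp]: "\<forall>t\<in>set ts. t = Leaf \<Longrightarrow> nodes_from j ts = []"
  by (induction ts arbitrary: j) simp_all

lemma mem_nodes_from:
  "(p, s) \<in> set (nodes_from j ts) \<longleftrightarrow>
    (\<exists>i q. i < length ts \<and> p = (j + i) # q \<and> (q, s) \<in> set (nodes (ts ! i)))"
proof (induction ts arbitrary: j)
  case (Cons t ts)
  have "(\<exists>i q. i < length (t # ts) \<and> p = (j + i) # q \<and> (q, s) \<in> set (nodes ((t # ts) ! i)))
    \<longleftrightarrow> (\<exists>q. p = j # q \<and> (q, s) \<in> set (nodes t)) \<or>
      (\<exists>i q. i < length ts \<and> p = (Suc j + i) # q \<and> (q, s) \<in> set (nodes (ts ! i)))"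
    (is "?L \<longleftrightarrow> ?R")
  proof
    assume ?L
    then obtain i q where "i < length (t # ts)" "p = (j + i) # q"
      "(q, s) \<in> set (nodes ((t # ts) ! i))" by blast
    then show ?R by (cases i) auto
  next
    assume ?R
    then show ?L
    proof
      assume "\<exists>q. p = j # q \<and> (q, s) \<in> set (nodes t)"
      then show ?L by (intro exI [of _ 0]) auto
    next
      assume "\<exists>i q. i < length ts \<and> p = (Suc j + i) # q \<and> (q, s) \<in> set (nodes (ts ! i))"
      then obtain i q where "i < length ts" "p = (Suc j + i) # q" "(q, s) \<in> set (nodes (ts ! i))"
        by blast
      then show ?L by (intro exI [of _ "Suc i"]) auto
    qed
  qed
  moreover have "(p, s) \<in> set (nodes_from j (t # ts)) \<longleftrightarrow>
      (\<exists>q. p = j # q \<and> (q, s) \<in> set (nodes t)) \<or> (p, s) \<in> set (nodes_from (Suc j) ts)"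
    by (auto simp: apfst_def map_prod_def image_iff split: prod.splits) 
  ultimately show ?case unfolding Cons.IH by blast
qed simp

lemma mem_nodes_Node:
  "(p, s') \<in> set (nodes (Node s ts)) \<longleftrightarrow> p = [] \<and> s' = s \<or>
    (\<exists>i q. i < length ts \<and> p = Suc i # q \<and> (q, s') \<in> set (nodes (ts ! i)))"
  by (simp add: mem_nodes_from)

section \<open>Preorder as the lexicographic order of addresses\<close>

text \<open>Under \<open>lexord\<close> a proper prefix precedes its extensions, as a node precedes
  its descendants in preorder.\<close>

abbreviation plex :: "nat list \<Rightarrow> nat list \<Rightarrow> bool" (infix "\<lless>" 50) where
  "p \<lless> q \<equiv> (p, q) \<in> lexord less_than"

lemma plex_irrefl: "\<not> p \<lless> p"
  by (induction p) auto

lemma plex_asym: "p \<lless> q \<Longrightarrow> \<not> q \<lless> p"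
  by (metis lexord_transI plex_irrefl trans_less_than transD)

text \<open>The root has the empty address, nodes in different children differ in the first entry,
  and nodes in the same child are covered by induction. Hence addresses are distinct and their order
  is that of the numbers.\<close>

lemma sorted_nodes: "sorted_wrt (\<lless>) (map fst (nodes t))"
proof (induction t)
  case (Node s ts)
  have "sorted_wrt (\<lless>) (map fst (nodes_from j ts))" for j
    using Node
  proof (induction ts arbitrary: j)
    case (Cons t ts)
    have "sorted_wrt (\<lless>) (map (fst \<circ> apfst ((#) j)) (nodes t))"
      using Cons.prems by (auto simp: sorted_wrt_map)
    moreover have "sorted_wrt (\<lless>) (map fst (nodes_from (Suc j) ts))"
      using Cons by simp
    ultimately show ?case
      by (force simp: sorted_wrt_append mem_nodes_from)
  qed simp
  then show ?case
    by (force simp: mem_nodes_from)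
qed simp

lemma nth_nodes: "1 \<le> i \<Longrightarrow> i \<le> deg t \<Longrightarrow> nodes t ! (i - 1) = (addr t i, dc t ! (i - 1))"
  by (simp add: deg_def addr_def dc_def)

lemma addr_mem: "1 \<le> i \<Longrightarrow> i \<le> deg t \<Longrightarrow> (addr t i, dc t ! (i - 1)) \<in> set (nodes t)"
  unfolding nth_nodes [symmetric] by (rule nth_mem) (auto simp: deg_def)

lemma mem_nodesE:
  assumes "(p, s) \<in> set (nodes t)"
  obtains i where "1 \<le> i" "i \<le> deg t" "addr t i = p" "dc t ! (i - 1) = s"
proof -
  from assms obtain j where "j < length (nodes t)" "nodes t ! j = (p, s)"
    by (auto simp: in_set_conv_nth)
  then show ?thesis
    using that [of "Suc j"] by (auto simp: deg_def addr_def dc_def)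
qed

lemma addr_less_iff:
  assumes "1 \<le> i" "i \<le> deg t" "1 \<le> j" "j \<le> deg t"
  shows "addr t i \<lless> addr t j \<longleftrightarrow> i < j"
proof -
  have *: "addr t i \<lless> addr t j" if "1 \<le> i" "j \<le> deg t" "i < j" for i j
    using sorted_wrt_nth_less [OF sorted_nodes [of t], of "i - 1" "j - 1"] that
    by (auto simp: addr_def deg_def)
  show ?thesis
    using * [of i j] * [of j i] assms plex_asym plex_irrefl by (metis linorder_neqE_nat)
qed

lemma addr_inj:
  assumes "1 \<le> i" "i \<le> deg t" "1 \<le> j" "j \<le> deg t" "addr t i = addr t j"
  shows "i = j"
  using assms addr_less_iff [of i t j] addr_less_iff [of j t i] plex_irrefl by (metis linorder_neqE_nat)

lemma num_addr: "1 \<le> i \<Longrightarrow> i \<le> deg t \<Longrightarrow> num t (addr t i) = i"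
  unfolding num_def by (rule the_equality) (auto intro: addr_inj)

lemma addr_one: "t \<noteq> Leaf \<Longrightarrow> addr t 1 = []"
  by (cases t) (simp_all add: addr_def)

section \<open>Parents and positions among siblings\<close>

lemma nodes_parent:
  assumes "t \<in> sterms S ar" "(p @ [k], s) \<in> set (nodes t)"
  shows "\<exists>s'. (p, s') \<in> set (nodes t) \<and> 1 \<le> k \<and> k \<le> ar s'"
  using assms
proof (induction t arbitrary: p rule: stm.induct)
  case (Node r ts)
  from Node.prems(2) obtain i q where i: "i < length ts" "p @ [k] = Suc i # q"
    "(q, s) \<in> set (nodes (ts ! i))"
    by (auto simp: mem_nodes_from)
  from Node.prems(1) have len: "length ts = ar r" and ts: "\<forall>t\<in>set ts. t \<in> sterms S ar"
    by (simp_all add: sterms_Node_iff)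
  show ?case
  proof (cases p)
    case Nil
    then show ?thesis using i len by auto
  next
    case (Cons j p')
    then have "(p' @ [k], s) \<in> set (nodes (ts ! i))" "j = Suc i"
      using i by auto
    then show ?thesis
      using Node.IH [of "ts ! i" p'] ts i(1) Cons by (fastforce simp: mem_nodes_from)
  qed
qed simp

text \<open>The parent's address is the node's address without its last entry: a proper prefix,
  hence earlier in preorder. So the definite description behind \<open>pa\<close> denotes an actual
  node.\<close>

lemma parent_edge:
  assumes t: "t \<in> sterms S ar" and i: "2 \<le> i" "i \<le> deg t"
  shows "addr t i = addr t (pa t i) @ [lp t i]" and "1 \<le> pa t i" and "pa t i < i"
    and "1 \<le> lp t i" and "lp t i \<le> ar (dc t ! (pa t i - 1))"
proof -
  have "t \<noteq> Leaf"
    using i by (auto simp: deg_def)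
  then have "addr t i \<noteq> []"
    using addr_one [of t] addr_inj [of i t 1] i by fastforce
  then have split: "addr t i = butlast (addr t i) @ [last (addr t i)]"
    by simp
  moreover have "(addr t i, dc t ! (i - 1)) \<in> set (nodes t)"
    using addr_mem [of i t] i by simp
  ultimately obtain s where s: "(butlast (addr t i), s) \<in> set (nodes t)"
      "1 \<le> last (addr t i)" "last (addr t i) \<le> ar s"
    using nodes_parent [OF t] by metis
  from s(1) obtain j where j: "1 \<le> j" "j \<le> deg t" "addr t j = butlast (addr t i)"
      "dc t ! (j - 1) = s"
    by (rule mem_nodesE)
  have pa: "pa t i = j"
    using i j num_addr [of j t] by (simp add: pa_def)
  have lp: "lp t i = last (addr t i)"
    using i by (simp add: lp_def)
  have "addr t j \<lless> addr t i"
    by (subst split, unfold j(3)) (rule lexord_append_rightI, simp)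
  then show "pa t i < i"
    using addr_less_iff [of j t i] j i pa by simp
  show "addr t i = addr t (pa t i) @ [lp t i]" "1 \<le> pa t i" "1 \<le> lp t i"
    "lp t i \<le> ar (dc t ! (pa t i - 1))"
    using split pa lp j s by simp_all
qed

section \<open>Recovering a term from its nodes\<close>

text \<open>The node list splits by first address entries into blocks, one per child. An empty block
  means a leaf, and the arity fixes the number of children.\<close>

lemma nodes_inject:
  assumes "t \<in> sterms S ar" "u \<in> sterms S ar" "nodes t = nodes u"
  shows "t = u"
  using assms
proof (induction t arbitrary: u rule: stm.induct)
  case Leaf
  then show ?case by (metis nodes.simps(1) nodes_eq_Nil_iff)
next
  case (Node s ts)
  then obtain us where u: "u = Node s us" by (cases u) auto
  have len: "length ts = length us"
    using Node.prems u by (simp add: sterms_Node_iff)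
  have "nodes_from 1 ts = nodes_from 1 us"
    using Node.prems(3) u by simp
  have sub: "\<forall>t\<in>set ts. t \<in> sterms S ar" "\<forall>t\<in>set us. t \<in> sterms S ar"
    using Node.prems u by (simp_all add: sterms_Node_iff)
  have "map nodes ts = map nodes us" if "nodes_from j ts = nodes_from j us" for j
    using len that
  proof (induction ts us arbitrary: j rule: list_induct2)
    case (Cons t ts u us)
    \<comment> \<open>Later children only have addresses whose first entry exceeds \<open>j\<close>,
      so this filter cuts out the block of the first child.\<close>
    let ?f = "filter (\<lambda>x. hd (fst x) = j)"
    have A: "?f (nodes_from j (x # xs)) = map (apfst ((#) j)) (nodes x)" for x :: "'a stm" and xs
    proof -
      have "hd (fst y) \<noteq> j" if y: "y \<in> set (nodes_from (Suc j) xs)" for y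
      proof -
        from y have "(fst y, snd y) \<in> set (nodes_from (Suc j) xs)"
          by simp
        then obtain i q where "fst y = (Suc j + i) # q"
          unfolding mem_nodes_from by blast
        then show ?thesis by simp
      qed
      then have "?f (nodes_from (Suc j) xs) = []"
        by simp
      then show ?thesis by (simp add: filter_map comp_def)
    qed
    have inj: "inj (apfst ((#) j))"
      by (auto simp: inj_def)
    have "map (apfst ((#) j)) (nodes t) = map (apfst ((#) j)) (nodes u)"
      using A Cons.prems by metis
    then have "nodes t = nodes u"
      using inj by (simp add: inj_map_eq_map)
    then show ?case using Cons by simp
  qed simp
  then have nd: "map nodes ts = map nodes us"
    using \<open>nodes_from 1 ts = nodes_from 1 us\<close> by blast
  have "ts = us"
  proof (rule nth_equalityI [OF len])
    fix i assume i: "i < length ts"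
    have "nodes (ts ! i) = nodes (us ! i)"
      using nd i len by (metis nth_map)
    then show "ts ! i = us ! i"
      using Node.IH sub i len by simp
  qed
  then show ?case using u by simp
qed

lemma eq_of_addr:
  assumes "t \<in> sterms S ar" "u \<in> sterms S ar" "dc t = dc u"
    and "\<And>i. 1 \<le> i \<Longrightarrow> i \<le> deg t \<Longrightarrow> addr t i = addr u i"
  shows "t = u"
proof -
  have len: "length (nodes t) = length (nodes u)"
    using assms(3) by (metis dc_def length_map)
  have "nodes t = nodes u"
  proof (rule nth_equalityI [OF len])
    fix j assume j: "j < length (nodes t)"
    have "addr t (Suc j) = addr u (Suc j)"
      using assms(4) j by (simp add: deg_def)
    moreover have "map snd (nodes t) ! j = map snd (nodes u) ! j"
      using assms(3) by (simp add: dc_def)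
    ultimately show "nodes t ! j = nodes u ! j"
      using j len by (simp add: addr_def prod_eq_iff)
  qed
  then show ?thesis using assms(1,2) nodes_inject by blast
qed

section \<open>Terms whose leaves come last\<close>

text \<open>All leaves come after all internal nodes in preorder.\<close>

fun packed :: "'s stm \<Rightarrow> bool" where
  "packed Leaf = True"
| "packed (Node s ts) \<longleftrightarrow>
    (\<forall>t\<in>set ts. packed t) \<and> sorted_wrt (\<lambda>t u. has_leaf t \<longrightarrow> u = Leaf) ts"

text \<open>Used contrapositively: a slot that holds no internal node witnesses a leaf in the
  subterm around it.\<close>

lemma full_nodes:
  assumes "t \<in> sterms S ar" "\<not> has_leaf t" "(p, s) \<in> set (nodes t)" "1 \<le> k" "k \<le> ar s"
  shows "p @ [k] \<in> fst ` set (nodes t)"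
  using assms
proof (induction t arbitrary: p rule: stm.induct)
  case (Node r ts)
  from Node.prems(1) have len: "length ts = ar r" and ts: "\<forall>t\<in>set ts. t \<in> sterms S ar"
    by (simp_all add: sterms_Node_iff)
  have full: "\<not> has_leaf t" if "t \<in> set ts" for t
    using Node.prems(2) that by auto
  consider "p = []" "s = r" | i q where "i < length ts" "p = Suc i # q" "(q, s) \<in> set (nodes (ts ! i))"
    using Node.prems(3) by (auto simp: mem_nodes_from)
  then show ?case
  proof cases
    case 1
    then have k: "k - 1 < length ts" using Node.prems len by simp
    then obtain r' us where "ts ! (k - 1) = Node r' us"
      using full [of "ts ! (k - 1)"] by (cases "ts ! (k - 1)") auto
    then have "([k], r') \<in> set (nodes (Node r ts))"
      unfolding mem_nodes_Node using k Node.prems(4) by (intro disjI2 exI [of _ "k - 1"]) simp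
    then show ?thesis using 1 by force
  next
    case 2
    then obtain s' where "(q @ [k], s') \<in> set (nodes (ts ! i))"
      using Node.IH [of "ts ! i" q] ts full Node.prems by fastforce
    then have "(p @ [k], s') \<in> set (nodes (Node r ts))"
      unfolding mem_nodes_Node using 2 by auto
    then show ?thesis by force
  qed
qed simp

text \<open>The address \<open>p @ [k]\<close> is that of a leaf. A node in a child to the right of
  this leaf is impossible, since \<open>packed\<close> turns those children into leaves; within the
  same child induction applies.\<close>

lemma packed_leaf_last:
  assumes "t \<in> sterms S ar" "packed t" "(p, s) \<in> set (nodes t)" "1 \<le> k" "k \<le> ar s"
    and "p @ [k] \<notin> fst ` set (nodes t)" "q \<in> fst ` set (nodes t)"
  shows "q \<lless> p @ [k]"
  using assms
proof (induction t arbitrary: p q rule: stm.induct)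
  case (Node r ts)
  from Node.prems(1) have len: "length ts = ar r" and ts: "\<forall>t\<in>set ts. t \<in> sterms S ar"
    by (simp_all add: sterms_Node_iff)
  have order: "ts ! j = Leaf" if "i < j" "j < length ts" "has_leaf (ts ! i)" for i j
    using Node.prems(2) that by (auto simp: sorted_wrt_iff_nth_less)
  have sub: "Suc i # x \<in> fst ` set (nodes (Node r ts))"
    if "x \<in> fst ` set (nodes (ts ! i))" "i < length ts" for i x
  proof -
    from that obtain y where "(x, y) \<in> set (nodes (ts ! i))" by auto
    then have "(Suc i # x, y) \<in> set (nodes (Node r ts))"
      unfolding mem_nodes_Node using that by blast
    then show ?thesis by force
  qed
  show ?case
  proof (cases "q = []")
    case True
    then show ?thesis by (cases p) auto
  next
    case False
    then obtain j q' where j: "j < length ts" "q = Suc j # q'" "q' \<in> fst ` set (nodes (ts ! j))"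
      using Node.prems(7) by (force simp: mem_nodes_from)
    consider "p = []" "s = r"
      | i p' where "i < length ts" "p = Suc i # p'" "(p', s) \<in> set (nodes (ts ! i))"
      using Node.prems(3) by (auto simp: mem_nodes_from)
    then show ?thesis
    proof cases
      case 1
      have k: "k - 1 < length ts" "k = Suc (k - 1)"
        using 1 Node.prems len by simp_all
      \<comment> \<open>A non-leaf child would contribute its root, whose address is
        \<open>[k]\<close>. Positions start at 1, list indices at 0.\<close>
      have "ts ! (k - 1) = Leaf"
      proof (rule ccontr)
        assume "ts ! (k - 1) \<noteq> Leaf"
        then have "[] \<in> fst ` set (nodes (ts ! (k - 1)))"
          by (cases "ts ! (k - 1)") auto
        then show False using sub [OF _ k(1)] k(2) Node.prems(6) 1 by auto
      qed
      then have "\<not> k - 1 \<le> j"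
        using order [of "k - 1" j] j by (cases "k - 1 = j") auto
      then show ?thesis using 1 j by simp
    next
      case 2
      have nin: "p' @ [k] \<notin> fst ` set (nodes (ts ! i))"
        using sub [of "p' @ [k]" i] 2 Node.prems(6) by auto
      then have "has_leaf (ts ! i)"
        using full_nodes [of "ts ! i" S ar p' s k] ts 2 Node.prems by auto
      then have "j \<le> i"
        using order [of i j] j by (cases "j \<le> i") auto
      moreover have "q' \<lless> p' @ [k]" if "j = i"
        using Node.IH [of "ts ! i" p' q'] ts 2 j that nin Node.prems by simp
      ultimately show ?thesis using 2 j by (cases "j = i") auto
    qed
  qed
qed simp

text \<open>An address strictly between \<open>q\<close> and \<open>q @ [l]\<close> extends
  \<open>q\<close> by an entry below \<open>l\<close>; this entry decides the comparison, whatever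
  is appended.\<close>

lemma plex_snoc:
  assumes "p = q \<and> k < l \<or> q \<lless> p \<and> p \<lless> q @ [l]"
  shows "p @ [k] \<lless> q @ [l]"
  using assms
proof (induction q arbitrary: p)
  case Nil
  then show ?case by (cases p) auto
next
  case (Cons a q)
  then show ?case by (cases p) auto
qed

text \<open>The slot \<open>k\<close> below the node \<open>q\<close> precedes the node \<open>i\<close> in preorder, so it cannot be a leaf.\<close>

lemma packed_before:
  assumes t: "t \<in> sterms S ar" "packed t" and i: "2 \<le> i" "i \<le> deg t" and q: "1 \<le> q" "q < i"
    and k: "1 \<le> k" "k \<le> ar (dc t ! (q - 1))"
    and less: "pa t i < q \<or> q = pa t i \<and> k < lp t i"
  obtains j where "1 \<le> j" "j < i" "addr t j = addr t q @ [k]"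
proof -
  note e = parent_edge [OF t(1) i]
  \<comment> \<open>The numbers \<open>pa t i < q < i\<close> translate into the betweenness that
    \<open>plex_snoc\<close> asks for, as \<open>addr t i\<close> is
    \<open>addr t (pa t i) @ [lp t i]\<close>.\<close>
  have "addr t q = addr t (pa t i) \<and> k < lp t i \<or>
      addr t (pa t i) \<lless> addr t q \<and> addr t q \<lless> addr t (pa t i) @ [lp t i]"
    using less addr_less_iff [of q t i] addr_less_iff [of "pa t i" t q] e q i by auto
  then have lt: "addr t q @ [k] \<lless> addr t i"
    using plex_snoc e(1) by metis
  have "addr t q @ [k] \<in> fst ` set (nodes t)"
  proof (rule ccontr)
    assume n: "addr t q @ [k] \<notin> fst ` set (nodes t)"
    have "addr t i \<in> fst ` set (nodes t)"
      using addr_mem [of i t] i by force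
    then have "addr t i \<lless> addr t q @ [k]"
      using packed_leaf_last [OF t addr_mem [of q t] k n] q i by simp
    then show False using lt plex_asym by blast
  qed
  then obtain s where "(addr t q @ [k], s) \<in> set (nodes t)"
    by auto
  then obtain j where "1 \<le> j" "j \<le> deg t" "addr t j = addr t q @ [k]"
    by (rule mem_nodesE)
  then show ?thesis using that lt addr_less_iff [of j t i] i by simp
qed

section \<open>Comparing connection words; maximality of packed terms\<close>

text \<open>The exponent is at most 0, so the subtracted power lies in (0, 1] and the parent is the
  integer part of \<open>cnc\<close>. For equal parents the arities agree as well, and the minus
  sign reverses the comparison of positions.\<close>

lemma cnc_le_iff:
  assumes t: "t \<in> sterms S ar" and u: "u \<in> sterms S ar" and dc: "dc t = dc u"
    and i: "2 \<le> i" "i \<le> deg t"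
  shows "cnc ar t i \<le> cnc ar u i \<longleftrightarrow> pa t i < pa u i \<or> pa t i = pa u i \<and> lp u i \<le> lp t i"
proof -
  have deg: "deg t = deg u"
    using dc by (metis deg_def dc_def length_map)
  have bounds: "of_nat (pa v i) \<le> cnc ar v i" "cnc ar v i < of_nat (pa v i) + 1"
    if v: "v \<in> sterms S ar" "i \<le> deg v" for v
  proof -
    let ?e = "int (lp v i) - int (ar (dc v ! (pa v i - 1)))"
    have "?e \<le> 0"
      using parent_edge(5) [OF v(1) i(1) v(2)] by simp
    then have "(2::rat) powi ?e \<le> 2 powi 0"
      by (intro power_int_increasing) simp_all
    moreover have "(0::rat) < 2 powi ?e"
      by simp
    ultimately show "of_nat (pa v i) \<le> cnc ar v i" "cnc ar v i < of_nat (pa v i) + 1"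
      by (simp_all add: cnc_def)
  qed
  note bt = bounds [OF t i(2)] and bu = bounds [OF u i(2) [unfolded deg]]
  consider "pa t i < pa u i" | "pa u i < pa t i" | "pa t i = pa u i"
    by linarith
  then show ?thesis
  proof cases
    case 1
    then have "(of_nat (pa t i) :: rat) + 1 \<le> of_nat (pa u i)"
      by (metis Suc_eq_plus1 Suc_leI of_nat_Suc add.commute of_nat_le_iff)
    then show ?thesis using 1 bt bu by linarith
  next
    case 2
    then have "(of_nat (pa u i) :: rat) + 1 \<le> of_nat (pa t i)"
      by (metis Suc_eq_plus1 Suc_leI of_nat_Suc add.commute of_nat_le_iff)
    then show ?thesis using 2 bt bu by linarith
  next
    case 3
    have "(2::rat) powi a \<le> 2 powi b \<longleftrightarrow> a \<le> b" for a b
      using power_int_increasing [of a b "2::rat"] power_int_strict_increasing [of b a "2::rat"]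
      by force
    then show ?thesis using 3 dc by (simp add: cnc_def)
  qed
qed

text \<open>The root's entry depends only on its decoration, so it agrees for terms with the same
  \<open>dc\<close>.\<close>

lemma cnc_one: "cnc ar t 1 = 2 - 2 powi - int (ar (dc t ! 0))"
  by (simp add: cnc_def pa_def lp_def)

lemma deg_eq: "deg t = length (dc t)"
  by (simp add: deg_def dc_def)

lemma packed_maximal:
  assumes t: "t \<in> sterms S ar" "packed t" and u: "u \<in> sterms S ar" and le: "wind_le ar t u"
  shows "u = t"
proof -
  have dc: "dc t = dc u" and cnc: "\<And>i. 1 \<le> i \<Longrightarrow> i \<le> deg t \<Longrightarrow> cnc ar t i \<le> cnc ar u i"
    using le by (auto simp: wind_le_def)
  then have deg: "deg t = deg u"
    by (simp add: deg_eq)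
  have "addr t i = addr u i" if "1 \<le> i" "i \<le> deg t" for i
    using that
  proof (induction i rule: less_induct)
    case (less i)
    then have "t \<noteq> Leaf" "u \<noteq> Leaf"
      using deg by (auto simp: deg_def)
    show ?case
    proof (cases "i = 1")
      case True
      then show ?thesis
        using \<open>t \<noteq> Leaf\<close> \<open>u \<noteq> Leaf\<close> by (metis addr_one)
    next
      case False
      then have it: "2 \<le> i" "i \<le> deg t" and iu: "2 \<le> i" "i \<le> deg u"
        using less.prems deg by simp_all
      note et = parent_edge [OF t(1) it] and eu = parent_edge [OF u iu]
      \<comment> \<open>The parent has a number below \<open>i\<close>, so the induction hypothesis
        covers it.\<close>
      have same: "addr t (pa u i) = addr u (pa u i)"
        using less eu by simp
      show ?thesis
      proof (cases "pa t i = pa u i \<and> lp t i = lp u i")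
        case True
        then show ?thesis using et(1) eu(1) same by simp
      next
        case False
        \<comment> \<open>The slot of \<open>i\<close> in \<open>u\<close> beats its slot in
          \<open>t\<close>, so in \<open>t\<close> an earlier node \<open>j\<close> already sits
          there. By induction \<open>j\<close> has that address in \<open>u\<close> too, where it
          clashes with \<open>i\<close>.\<close>
        then have "pa t i < pa u i \<or> pa u i = pa t i \<and> lp u i < lp t i"
          using cnc_le_iff [OF t(1) u dc it] cnc [of i] it by auto
        then obtain j where j: "1 \<le> j" "j < i" "addr t j = addr t (pa u i) @ [lp u i]"
          using packed_before [OF t it, of "pa u i" "lp u i"] eu dc by auto
        then have "addr u j = addr u i"
          using less.IH [of j] it eu(1) same by simp
        then show ?thesis
          using addr_inj [of j u i] j iu by simp
      qed
    qed
  qed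
  then show ?thesis
    using eq_of_addr [OF t(1) u dc] by simp
qed

section \<open>Brooms: minimality, and comparison with packed terms\<close>

text \<open>The shape of \<open>f_up\<close> over an arbitrary signature; the disjoint sum with the
  naturals enters only in the final theorem.\<close>

abbreviation broom :: "('s \<Rightarrow> nat) \<Rightarrow> 's \<Rightarrow> 's list \<Rightarrow> 's stm" where
  "broom ar s w \<equiv> Node s (map (corolla ar) w)"

lemma nodes_corolla [simp]: "nodes (corolla ar s) = [([], s)]"
  by (simp add: corolla_def)

lemma nodes_broom:
  "nodes (broom ar s w) = ([], s) # zip (map (\<lambda>i. [i]) [1..<Suc (length w)]) w"
proof -
  have "nodes_from j (map (corolla ar) w) = zip (map (\<lambda>i. [i]) [j..<j + length w]) w" for j
    by (induction w arbitrary: j) (simp_all add: upt_conv_Cons del: upt_Suc)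
  from this [of 1] show ?thesis by (simp only: nodes_Node plus_1_eq_Suc)
qed

lemma dc_broom: "dc (broom ar s w) = s # w"
  by (simp add: dc_def nodes_broom del: nodes_Node upt_Suc)

lemma addr_broom:
  assumes "2 \<le> i" "i \<le> Suc (length w)"
  shows "addr (broom ar s w) i = [i - 1]"
proof -
  obtain j where "i = Suc (Suc j)"
    using assms(1) by (metis add_2_eq_Suc le_Suc_ex)
  then show ?thesis
    using assms(2) by (simp add: addr_def nodes_broom del: nodes_Node upt_Suc)
qed

lemma corolla_sterms: "s \<in> S \<Longrightarrow> corolla ar s \<in> sterms S ar"
  by (simp add: corolla_def sterms_Node_iff sterms.Leaf)

lemma broom_sterms:
  "s \<in> S \<Longrightarrow> set w \<subseteq> S \<Longrightarrow> length w = ar s \<Longrightarrow> broom ar s w \<in> sterms S ar"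
  by (auto simp: sterms_Node_iff corolla_sterms)

lemma edge_broom:
  assumes "broom ar s w \<in> sterms S ar" "2 \<le> i" "i \<le> Suc (length w)"
  shows "pa (broom ar s w) i = 1" "lp (broom ar s w) i = i - 1"
proof -
  let ?b = "broom ar s w"
  have deg: "deg ?b = Suc (length w)"
    by (simp add: deg_eq dc_broom)
  have "addr ?b 1 = []"
    by (rule addr_one) simp
  then have "num ?b [] = 1"
    using num_addr [of 1 ?b] deg by simp
  then show "pa ?b i = 1" "lp ?b i = i - 1"
    using assms by (simp_all add: pa_def lp_def addr_broom)
qed

lemma broom_minimal:
  assumes b: "broom ar s w \<in> sterms S ar" and u: "u \<in> sterms S ar"
    and le: "wind_le ar u (broom ar s w)"
  shows "u = broom ar s w"
proof -
  let ?b = "broom ar s w" and ?n = "length w"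
  have dc: "dc u = dc ?b" and cnc: "\<And>i. 1 \<le> i \<Longrightarrow> i \<le> deg u \<Longrightarrow> cnc ar u i \<le> cnc ar ?b i"
    using le by (auto simp: wind_le_def)
  then have deg: "deg u = Suc ?n"
    by (simp add: deg_eq dc_broom)
  then have "u \<noteq> Leaf"
    by (auto simp: deg_def)
  have n: "?n = ar s"
    using b by (simp add: sterms_Node_iff)
  \<comment> \<open>In the broom, node \<open>i\<close> is child \<open>i - 1\<close> of the root.
    No parent has a number below 1, so being smaller forces the root as parent and a position at
    least \<open>i - 1\<close>.\<close>
  have edge: "addr u i = [lp u i]" "i - 1 \<le> lp u i" "lp u i \<le> ?n" if i: "2 \<le> i" "i \<le> Suc ?n" for i
  proof -
    have iu: "i \<le> deg u" using i deg by simp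
    note e = parent_edge [OF u i(1) iu]
    have "pa u i \<le> 1 \<and> i - 1 \<le> lp u i"
      using cnc_le_iff [OF u b dc i(1) iu] cnc [of i] i iu e(2) by (auto simp: edge_broom [OF b i])
    then have "pa u i = 1" "i - 1 \<le> lp u i"
      using e(2) by simp_all
    then show "addr u i = [lp u i]" "i - 1 \<le> lp u i" "lp u i \<le> ?n"
      using e(1,5) addr_one [OF \<open>u \<noteq> Leaf\<close>] dc n by (simp_all add: dc_broom)
  qed
  have "addr u i = addr ?b i" if i: "1 \<le> i" "i \<le> deg u" for i
  proof (cases "i = 1")
    case True
    then show ?thesis
      using \<open>u \<noteq> Leaf\<close> by (metis addr_one stm.distinct(1))
  next
    case False
    then have i: "2 \<le> i" "i \<le> Suc ?n"
      using i deg by simp_all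
    \<comment> \<open>Nodes \<open>i\<close> to \<open>?n + 1\<close> occupy distinct positions from
      \<open>lp u i\<close> to \<open>?n\<close>. Counting gives
      \<open>lp u i \<le> i - 1\<close>.\<close>
    have "lp u ` {i..Suc ?n} \<subseteq> {lp u i..?n}"
    proof (clarsimp simp del: image_subset_iff)
      fix j assume j: "i \<le> j" "j \<le> Suc ?n"
      then have "j = i \<or> addr u i \<lless> addr u j"
        using addr_less_iff [of i u j] i deg by auto
      then show "lp u i \<le> lp u j \<and> lp u j \<le> ?n"
        using edge [of i] edge [of j] i j by auto
    qed
    moreover have "inj_on (lp u) {i..Suc ?n}"
    proof (rule inj_onI)
      fix j k assume "j \<in> {i..Suc ?n}" "k \<in> {i..Suc ?n}" "lp u j = lp u k"
      then show "j = k"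
        using edge(1) [of j] edge(1) [of k] i deg addr_inj [of j u k] by simp
    qed
    ultimately have "card {i..Suc ?n} \<le> card {lp u i..?n}"
      by (intro card_inj_on_le) simp_all
    then have "lp u i = i - 1"
      using edge [of i] i by simp
    then show ?thesis
      using edge(1) [OF i] addr_broom [OF i] by simp
  qed
  then show ?thesis
    using eq_of_addr [OF u b dc] by simp
qed

text \<open>A node whose parent is not the root is automatically larger than in the broom, where
  every parent is the root; only positions below the root have to be bounded.\<close>

lemma broom_le_packed:
  assumes b: "broom ar s w \<in> sterms S ar" and t: "t \<in> sterms S ar" "packed t"
    and dc: "dc t = s # w"
  shows "wind_le ar (broom ar s w) t"
proof -
  let ?b = "broom ar s w"
  have deg: "deg ?b = Suc (length w)" "deg t = Suc (length w)"
    using dc by (simp_all add: deg_eq dc_broom)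
  then have "t \<noteq> Leaf"
    by (auto simp: deg_def)
  have "cnc ar ?b i \<le> cnc ar t i" if "i \<in> {1..deg ?b}" for i
  proof (cases "i = 1")
    case True
    then show ?thesis
      using dc cnc_one [of ar] by (simp add: dc_broom)
  next
    case False
    then have i: "2 \<le> i" "i \<le> Suc (length w)" and it: "i \<le> deg t"
      using that deg by simp_all
    note e = parent_edge [OF t(1) i(1) it]
    have "lp t i \<le> i - 1" if one: "pa t i = 1"
    proof -
      \<comment> \<open>Each root position left of node \<open>i\<close> holds an earlier node other
        than the root, so \<open>lp t i - 1 \<le> i - 2\<close>.\<close>
      have "{1..<lp t i} \<subseteq> lp t ` {2..<i}"
      proof
        fix k assume k: "k \<in> {1..<lp t i}"
        then obtain j where j: "1 \<le> j" "j < i" "addr t j = addr t 1 @ [k]"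
          using packed_before [OF t i(1) it, of 1 k] one e(5) i by auto
        then have "j \<noteq> 1"
          by auto
        then have "lp t j = k" "j \<in> {2..<i}"
          using j by (simp_all add: lp_def)
        then show "k \<in> lp t ` {2..<i}"
          by blast
      qed
      then have "card {1..<lp t i} \<le> card {2..<i}"
        by (intro surj_card_le) simp_all
      then show ?thesis
        using i by simp
    qed
    then show ?thesis
      using cnc_le_iff [OF b t(1) _ i(1)] deg(1) i dc e(2)
      by (auto simp: edge_broom [OF b i] dc_broom)
  qed
  then show ?thesis
    using dc by (simp add: wind_le_def dc_broom)
qed

section \<open>Grafting into packed terms\<close>

lemma dc_Leaf [simp]: "dc Leaf = []"
  by (simp add: dc_def)

lemma dc_Node [simp]: "dc (Node s ts) = s # concat (map dc ts)"
proof -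
  have "map snd (nodes_from j ts) = concat (map dc ts)" for j
    by (induction ts arbitrary: j) (simp_all add: dc_def)
  then show ?thesis
    by (simp add: dc_def)
qed

lemma dc_corolla [simp]: "dc (corolla ar s) = [s]"
  by (simp add: dc_def)

text \<open>A count refining \<open>has_leaf\<close>, needed to see that leaves do not run out
  during repeated grafting.\<close>

primrec nleaves :: "'s stm \<Rightarrow> nat" where
  "nleaves Leaf = 1"
| "nleaves (Node s ts) = sum_list (map nleaves ts)"

lemma has_leaf_iff: "has_leaf t \<longleftrightarrow> nleaves t \<noteq> 0"
  by (induction t) (auto simp: image_iff)

text \<open>In a packed term the leftmost leaf follows every internal node, so the nodes of
  \<open>u\<close> are appended at the end of the preorder. The leaf count uses \<open>Suc\<close>
  to avoid truncated subtraction.\<close>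

lemma graft_packed:
  assumes "packed u"
  shows "packed t \<Longrightarrow> has_leaf t \<Longrightarrow> packed (graft t u) \<and> dc (graft t u) = dc t @ dc u \<and>
      Suc (nleaves (graft t u)) = nleaves t + nleaves u"
    and "\<forall>t\<in>set ts. packed t \<Longrightarrow> sorted_wrt (\<lambda>t u. has_leaf t \<longrightarrow> u = Leaf) ts \<Longrightarrow>
      \<exists>t\<in>set ts. has_leaf t \<Longrightarrow>
      (\<forall>t\<in>set (graft_list ts u). packed t) \<and>
      sorted_wrt (\<lambda>t u. has_leaf t \<longrightarrow> u = Leaf) (graft_list ts u) \<and>
      concat (map dc (graft_list ts u)) = concat (map dc ts) @ dc u \<and>
      Suc (sum_list (map nleaves (graft_list ts u))) = sum_list (map nleaves ts) + nleaves u"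
  using assms
proof (induction t u and ts u rule: graft_graft_list.induct)
  case (4 t ts u)
  show ?case
  proof (cases "has_leaf t")
    case True
    \<comment> \<open>The leaf lies in the first child, so all later children are leaves and
      contribute no decorations.\<close>
    then have leaves: "\<forall>t\<in>set ts. t = Leaf"
      using 4 by simp
    then have "concat (map dc ts) = []" "\<forall>t\<in>set ts. packed t"
      by auto
    then show ?thesis
      using 4 True leaves by (simp del: concat_eq_Nil_conv)
  next
    case False
    then have eq: "graft_list (t # ts) u = t # graft_list ts u"
      by simp
    have "\<forall>t\<in>set ts. packed t" "sorted_wrt (\<lambda>t u. has_leaf t \<longrightarrow> u = Leaf) ts"
        "\<exists>t\<in>set ts. has_leaf t"
      using 4(3-5) False by simp_all
    note IH = 4(2) [OF False this 4(6)]
    have "\<forall>t\<in>set (t # graft_list ts u). packed t"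
      using IH 4(3) by auto
    moreover have "sorted_wrt (\<lambda>t u. has_leaf t \<longrightarrow> u = Leaf) (t # graft_list ts u)"
      using IH False by simp
    moreover have "concat (map dc (t # graft_list ts u)) = concat (map dc (t # ts)) @ dc u"
      using IH by (simp only: list.map concat.simps append_assoc)
    moreover have "Suc (sum_list (map nleaves (t # graft_list ts u))) =
        sum_list (map nleaves (t # ts)) + nleaves u"
      using IH unfolding list.map sum_list.Cons by linarith
    ultimately show ?thesis
      unfolding eq by (intro conjI)
  qed
qed auto

lemma graft_sterms:
  assumes "u \<in> sterms S ar"
  shows "t \<in> sterms S ar \<Longrightarrow> graft t u \<in> sterms S ar"
    and "\<forall>t\<in>set ts. t \<in> sterms S ar \<Longrightarrow>
      length (graft_list ts u) = length ts \<and> (\<forall>t\<in>set (graft_list ts u). t \<in> sterms S ar)"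
  using assms
  by (induction t u and ts u rule: graft_graft_list.induct) (simp_all add: sterms_Node_iff)

lemma packed_corolla: "packed (corolla ar s)"
  by (simp add: corolla_def sorted_wrt_iff_nth_less)

text \<open>The bound on \<open>length w\<close> is an invariant: each graft consumes one letter and
  at most one leaf.\<close>

lemma foldl_graft_corolla:
  assumes "t \<in> sterms S ar" "packed t" "length w \<le> nleaves t" "set w \<subseteq> S"
  shows "foldl graft t (map (corolla ar) w) \<in> sterms S ar \<and>
    packed (foldl graft t (map (corolla ar) w)) \<and>
    dc (foldl graft t (map (corolla ar) w)) = dc t @ w"
  using assms
proof (induction w arbitrary: t)
  case (Cons s w)
  have g: "packed (graft t (corolla ar s))" "dc (graft t (corolla ar s)) = dc t @ [s]"
      "length w \<le> nleaves (graft t (corolla ar s))"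
    using graft_packed(1) [OF packed_corolla, of t ar s] Cons.prems by (auto simp: has_leaf_iff)
  have "graft t (corolla ar s) \<in> sterms S ar"
    using graft_sterms(1) [OF corolla_sterms] Cons.prems by auto
  then show ?case
    using Cons.IH [OF _ g(1) g(3)] Cons.prems g(2) by simp
qed simp

section \<open>Invariance under tilting\<close>

text \<open>With leaf children already last, rearranging changes nothing at any node. Leaving
  \<open>P\<close> arbitrary settles all \<open>X\<close> at once.\<close>

lemma tilt_at_Node:
  assumes "\<And>t P. t \<in> set ts \<Longrightarrow> tilt_at t P = t" "sorted_wrt (\<lambda>t u. t = Leaf \<longrightarrow> u = Leaf) ts"
  shows "tilt_at (Node s ts) P = Node s ts"
proof -
  have "map (\<lambda>(j, f). f (\<lambda>p. P (j # p))) (enumerate 1 (map tilt_at ts)) = ts"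
    by (rule nth_equalityI) (simp_all add: nth_enumerate_eq assms(1))
  moreover have "filter (\<lambda>u. u \<noteq> Leaf) ts @ filter (\<lambda>u. u = Leaf) ts = ts"
    using assms(2)
  proof (induction ts)
    case (Cons t ts)
    then show ?case by (cases "t = Leaf") (auto simp: filter_empty_conv)
  qed simp
  ultimately show ?thesis
    by simp
qed

lemma tilt_at_packed: "packed t \<Longrightarrow> tilt_at t P = t"
proof (induction t arbitrary: P)
  case (Node s ts)
  \<comment> \<open>\<open>Leaf\<close> itself has a leaf, so the condition in \<open>packed\<close>
    is the stronger one.\<close>
  have "sorted_wrt (\<lambda>t u. t = Leaf \<longrightarrow> u = Leaf) ts"
    using Node.prems by (auto elim!: sorted_wrt_mono_rel [rotated])
  then show ?case
    using Node by (intro tilt_at_Node) simp_all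
qed simp

text \<open>A broom need not be packed, but no child of its root is a leaf and each child is
  packed.\<close>

lemma tilt_at_broom: "tilt_at (broom ar s w) P = broom ar s w"
  by (rule tilt_at_Node) (auto simp: tilt_at_packed packed_corolla sorted_wrt_iff_nth_less corolla_def
      simp del: tilt_at.simps)

theorem theorem4p1p1:
  fixes S :: "'s set" and ar :: "'s \<Rightarrow> nat" and X :: "nat set" and w :: "'s list"
  assumes "\<forall>x\<in>X. x > 0"
    and "set w \<subseteq> S"
  shows "(f_up ar w \<in> tilted (sigN S) (arN ar) X \<and>
          f_down ar w \<in> tilted (sigN S) (arN ar) X \<and>
          wind_le (arN ar) (f_up ar w) (f_down ar w)) \<and>
         minimal_in (tilted (sigN S) (arN ar) X) (wind_le (arN ar)) (f_up ar w) \<and>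
         maximal_in (tilted (sigN S) (arN ar) X) (wind_le (arN ar)) (f_down ar w)"
proof -
  let ?s = "Inr (length w)" and ?w = "map Inl w" and ?S = "sigN S" and ?ar = "arN ar"
  have up: "f_up ar w = broom ?ar ?s ?w"
    by (simp add: f_up_def comp_def)
  have down: "f_down ar w = foldl graft (corolla ?ar ?s) (map (corolla ?ar) ?w)"
    by (simp add: f_down_def comp_def)
  have S: "?s \<in> ?S" "set ?w \<subseteq> ?S" "?ar ?s = length w"
    using assms(2) by (auto simp: sigN_def arN_def)
  have b: "broom ?ar ?s ?w \<in> sterms ?S ?ar"
    using S by (intro broom_sterms) simp_all
  \<comment> \<open>The root corolla offers exactly one leaf per letter of \<open>w\<close>, which
    starts the invariant of \<open>foldl_graft_corolla\<close>.\<close>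
  have "nleaves (corolla ?ar ?s) = length w"
    using S(3) by (simp add: corolla_def sum_list_replicate)
  then have d: "f_down ar w \<in> sterms ?S ?ar" "packed (f_down ar w)" "dc (f_down ar w) = ?s # ?w"
    using foldl_graft_corolla [OF corolla_sterms [OF S(1)] packed_corolla _ S(2)]
    by (simp_all add: down)
  have "f_up ar w \<in> tilted ?S ?ar X" "f_down ar w \<in> tilted ?S ?ar X"
    using b d tilt_at_broom [of ?s ?ar ?w] tilt_at_packed [OF d(2)]
    by (simp_all only: tilted_def tlt_def up mem_Collect_eq simp_thms)
  moreover have "wind_le ?ar (f_up ar w) (f_down ar w)"
    unfolding up using b d by (rule broom_le_packed)
  \<comment> \<open>Both extremality results hold among all terms over the signature, hence also
    among the tilted ones.\<close>
  moreover have "u = f_up ar w" if "u \<in> tilted ?S ?ar X" "wind_le ?ar u (f_up ar w)" for u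
    using broom_minimal [OF b] that unfolding up tilted_def by blast
  moreover have "u = f_down ar w" if "u \<in> tilted ?S ?ar X" "wind_le ?ar (f_down ar w) u" for u
    using packed_maximal [OF d(1,2)] that unfolding tilted_def by blast
  ultimately show ?thesis
    unfolding minimal_in_def maximal_in_def by blast
qed

end
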